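(* Let $\gamma:S^1\rightarrow\mathbb{R}^2$ be a Jordan curve. Then there exists a nonempty open interval $I\subseteq\mathbb{R}$ of angles such that for every $\theta\in I$ there exists an inscribed rhombus of $\gamma$ of angle $\theta$. Furthermore, if $\gamma$ does not contain a special corner, then for every $\theta\in\mathbb{R}$ there exists an inscribed rhombus of $\gamma$ of angle $\theta$.
   Context: A Jordan curve is a continuous injective map $\gamma:S^1\to\mathbb{R}^2$; no regularity is assumed. Its image is denoted $\operatorname{im}(\gamma)$. A line of angle $\theta$ ($\theta\in\mathbb{R}$) is a line in $\mathbb{R}^2$ of the form $x\sin\theta-y\cos\theta=\text{constant}$, i.e. a line making angle $\theta$ with the $x$-axis in the anti-clockwise sense. A special corner of $\gamma$ of angle $\theta$ is a point $p\in \operatorname{im}(\gamma)$ such that both the line of angle $\theta$ through $p$ and the line of angle $\theta+\frac{\pi}{2}$ through $p$ intersect $\operatorname{im}(\gamma)$ only at $p$. A point $p$ is a special corner of $\gamma$ if it is a special corner of $\gamma$ of at least one angle $\theta$. A rhombus of angle $\theta$ is a rhombus in $\mathbb{R}^2$ whose two diagonals lie on lines of angles $\theta$ and $\theta+\frac{\pi}{2}$ respectively (so "angle $\theta$" and "angle $\theta+\frac{\pi}{2}$" are the same concept for rhombi). An inscribed rhombus of $\gamma$ is a set of 4 distinct points in $\operatorname{im}(\gamma)$ which are the vertices of a rhombus in $\mathbb{R}^2$; it is an inscribed rhombus of angle $\theta$ if that rhombus is a rhombus of angle $\theta$. *)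

theory Defs
  imports "HOL-Analysis.Analysis"
begin

type_synonym plane = "real ^ 2"

text \<open>The circle is the unit circle of the complex plane; values of \<open>\<gamma>\<close> off the circle are
  irrelevant.\<close>

definition jordan_curve :: "(complex \<Rightarrow> plane) \<Rightarrow> bool" where
  "jordan_curve \<gamma> \<longleftrightarrow> continuous_on (sphere 0 1) \<gamma> \<and> inj_on \<gamma> (sphere 0 1)"

definition curve_image :: "(complex \<Rightarrow> plane) \<Rightarrow> plane set" where
  "curve_image \<gamma> = \<gamma> ` sphere 0 1"

definition line_of_angle :: "real \<Rightarrow> plane set \<Rightarrow> bool" where
  "line_of_angle \<theta> L \<longleftrightarrow> (\<exists>c. L = {p. p $ 1 * sin \<theta> - p $ 2 * cos \<theta> = c})"

definition special_corner_of_angle :: "(complex \<Rightarrow> plane) \<Rightarrow> real \<Rightarrow> plane \<Rightarrow> bool" where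
  "special_corner_of_angle \<gamma> \<theta> p \<longleftrightarrow>
     p \<in> curve_image \<gamma> \<and>
     (\<exists>L M. line_of_angle \<theta> L \<and> line_of_angle (\<theta> + pi / 2) M \<and> p \<in> L \<and> p \<in> M \<and>
            L \<inter> curve_image \<gamma> = {p} \<and> M \<inter> curve_image \<gamma> = {p})"

definition special_corner :: "(complex \<Rightarrow> plane) \<Rightarrow> plane \<Rightarrow> bool" where
  "special_corner \<gamma> p \<longleftrightarrow> (\<exists>\<theta>. special_corner_of_angle \<gamma> \<theta> p)"

text \<open>A rhombus is given by its vertices in cyclic order; its sides are \<open>ab\<close>, \<open>bc\<close>, \<open>cd\<close>, \<open>da\<close> and
  its diagonals are \<open>ac\<close> and \<open>bd\<close>. In the plane, distinctness of the vertices together with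
  equality of the sides rules out degenerate quadrilaterals. Squares are rhombi.\<close>

definition rhombus :: "plane \<Rightarrow> plane \<Rightarrow> plane \<Rightarrow> plane \<Rightarrow> bool" where
  "rhombus a b c d \<longleftrightarrow>
     distinct [a, b, c, d] \<and> dist a b = dist b c \<and> dist b c = dist c d \<and> dist c d = dist d a"

text \<open>Which diagonal has angle \<open>\<theta>\<close> is immaterial below, because the labelling of the vertices can
  be rotated.\<close>

definition rhombus_of_angle :: "real \<Rightarrow> plane \<Rightarrow> plane \<Rightarrow> plane \<Rightarrow> plane \<Rightarrow> bool" where
  "rhombus_of_angle \<theta> a b c d \<longleftrightarrow>
     rhombus a b c d \<and>
     (\<exists>L M. line_of_angle \<theta> L \<and> line_of_angle (\<theta> + pi / 2) M \<and>
            closed_segment a c \<subseteq> L \<and> closed_segment b d \<subseteq> M)"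

definition inscribed_rhombus_of_angle :: "(complex \<Rightarrow> plane) \<Rightarrow> real \<Rightarrow> plane set \<Rightarrow> bool" where
  "inscribed_rhombus_of_angle \<gamma> \<theta> R \<longleftrightarrow>
     R \<subseteq> curve_image \<gamma> \<and> (\<exists>a b c d. R = {a, b, c, d} \<and> rhombus_of_angle \<theta> a b c d)"

end

theory Submission
  imports Defs
begin

text \<open>
  Write \<open>Y = coord \<theta>\<close> and \<open>X = coord (\<theta> + pi / 2)\<close> for the orthonormal coordinates whose level lines
  have angle \<open>\<theta>\<close> and \<open>\<theta> + pi / 2\<close>. A rhombus of angle \<open>\<theta>\<close> is a pair of nondegenerate chords with a
  common midpoint, one chord having its ends at equal \<open>Y\<close> and the other having its ends at equal \<open>X\<close>.

  To find such chords on a curve, take two paths in it that descend from a highest to a lowest point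
  with respect to \<open>Y\<close>, and two that do the same with respect to \<open>X\<close>. The first chord gets one end
  on each of the first two paths, the second chord one end on each of the other two. This gives four
  unknown parameters in \<open>[0, 1]\<close> and four equations, and the values at the ends of the paths have
  the signs that the Poincare-Miranda theorem asks for (\<open>chord_crossing\<close>).

  The danger is that the solution degenerates to a single point. On a Jordan curve the two paths can
  be chosen to meet only in a point that is the unique highest or the unique lowest point of the
  curve (\<open>full_descents_meeting_at_extremes\<close>): if there are several highest points, the paths start
  at different ones. If then one of the two chords is a point, it is extremal, so the other chord
  shrinks to the same point, and this point is strictly extremal for both coordinates, hence a
  special corner (\<open>midpoint_chords_nondegenerate\<close>).

  The argument survives a small rotation. Keep the paths that were chosen for \<open>\<theta>\<close>, and for \<open>\<phi>\<close> near
  \<open>\<theta>\<close> truncate the rotated coordinates to a range that the paths still cover. Solutions for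
  \<open>\<phi> \<longlonglongrightarrow> \<theta>\<close> accumulate at a solution for \<open>\<theta>\<close>, which is nondegenerate and stays away from the ends of
  the range if \<open>\<theta>\<close> has no special corner; so they are nondegenerate and untruncated for \<open>\<phi>\<close> close to
  \<open>\<theta>\<close> (\<open>rhombi_near_cornerless_angle\<close>). This proves the assertion on curves without special
  corners, and it gives an interval of angles as soon as one angle has no special corner. The
  direction of a diameter of the curve is such an angle (\<open>cornerless_angle_exists\<close>).
\<close>

section \<open>Crossing chords from Brouwer's fixed point theorem\<close>

text \<open>A fixed point of \<open>z \<mapsto> z + F z\<close>, clamped to the cube, is a zero of \<open>F\<close>: where the
  clamping is active in the \<open>i\<close>-th coordinate, the sign conditions on the two opposite faces force
  \<open>F z $ i = 0\<close>.\<close>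

lemma poincare_miranda:
  fixes F :: "real ^ 'n \<Rightarrow> real ^ 'n"
  assumes cont: "continuous_on (cbox 0 1) F"
    and lower: "\<And>z i. z \<in> cbox 0 1 \<Longrightarrow> z $ i = 0 \<Longrightarrow> 0 \<le> F z $ i"
    and upper: "\<And>z i. z \<in> cbox 0 1 \<Longrightarrow> z $ i = 1 \<Longrightarrow> F z $ i \<le> 0"
  obtains z where "z \<in> cbox 0 1" "F z = 0"
proof -
  define G where "G z = (\<chi> i. max 0 (min 1 (z $ i + F z $ i)))" for z
  have "continuous_on (cbox 0 1) G"
    unfolding G_def using cont
    by (intro continuous_on_vec_lambda continuous_intros)
  moreover have "G \<in> cbox 0 1 \<rightarrow> cbox 0 1"
    by (auto simp: G_def mem_box_cart)
  moreover have "(0 :: real ^ 'n) \<in> cbox 0 1"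
    by (simp add: mem_box_cart)
  ultimately obtain z where z: "z \<in> cbox 0 1" and fix_z: "G z = z"
    using brouwer[of "cbox 0 (1 :: real ^ 'n)" G] by (metis compact_cbox convex_box(1) empty_iff)
  have "F z $ i = 0" for i
  proof -
    have *: "max 0 (min 1 (z $ i + F z $ i)) = z $ i"
      using fix_z by (metis G_def vec_lambda_beta)
    have "0 \<le> z $ i" "z $ i \<le> 1"
      using z by (auto simp: mem_box_cart)
    with * lower[OF z, of i] upper[OF z, of i] show ?thesis
      by (auto simp: max_def min_def split: if_splits)
  qed
  then have "F z = 0"
    by (simp add: vec_eq_iff)
  with z show thesis by (rule that)
qed

definition trunc :: "real \<Rightarrow> real \<Rightarrow> real \<Rightarrow> real" where
  "trunc lo hi x = max lo (min hi x)"

lemma continuous_on_trunc [continuous_intros]: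
  "continuous_on S f \<Longrightarrow> continuous_on S (\<lambda>x. trunc lo hi (f x))"
  unfolding trunc_def by (intro continuous_intros)

lemma tendsto_trunc:
  assumes "(lo \<longlongrightarrow> lo') F" "(hi \<longlongrightarrow> hi') F" "(f \<longlongrightarrow> x) F"
  shows "((\<lambda>n. trunc (lo n) (hi n) (f n)) \<longlongrightarrow> trunc lo' hi' x) F"
  unfolding trunc_def by (intro tendsto_intros assms)

lemma trunc_le_trunc: "hi \<le> x \<Longrightarrow> trunc lo hi y \<le> trunc lo hi x"
  and trunc_ge_trunc: "x \<le> lo \<Longrightarrow> trunc lo hi x \<le> trunc lo hi y"
  and trunc_ident: "lo \<le> x \<Longrightarrow> x \<le> hi \<Longrightarrow> trunc lo hi x = x"
  by (auto simp: trunc_def)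

text \<open>The paths \<open>P1\<close>, \<open>P2\<close> carry the ends of a chord with equal \<open>Y\<close>, and \<open>P3\<close>, \<open>P4\<close> those of a
  chord with equal \<open>X\<close>. In each coordinate the midpoint of one chord must agree with both ends of
  the other one, and this is a square system. The coordinates are only compared
  after truncation, so that a path need not start and end exactly at the levels that bound the
  range.\<close>

lemma chord_crossing:
  fixes P1 P2 P3 P4 :: "real \<Rightarrow> 'a::real_normed_vector" and X Y :: "'a \<Rightarrow> real"
  assumes cont: "continuous_on {0..1} P1" "continuous_on {0..1} P2"
      "continuous_on {0..1} P3" "continuous_on {0..1} P4"
      "continuous_on UNIV X" "continuous_on UNIV Y"
    and Y_start: "t \<le> Y (P1 0)" "t \<le> Y (P2 0)" and Y_end: "Y (P1 1) \<le> b" "Y (P2 1) \<le> b"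
    and X_start: "r \<le> X (P3 0)" "r \<le> X (P4 0)" and X_end: "X (P3 1) \<le> l" "X (P4 1) \<le> l"
  obtains z :: "real ^ 4" where "z \<in> cbox 0 1"
    "trunc b t (Y (P1 (z $ 1))) = trunc b t (Y (midpoint (P3 (z $ 3)) (P4 (z $ 4))))"
    "trunc b t (Y (P2 (z $ 2))) = trunc b t (Y (midpoint (P3 (z $ 3)) (P4 (z $ 4))))"
    "trunc l r (X (P3 (z $ 3))) = trunc l r (X (midpoint (P1 (z $ 1)) (P2 (z $ 2))))"
    "trunc l r (X (P4 (z $ 4))) = trunc l r (X (midpoint (P1 (z $ 1)) (P2 (z $ 2))))"
proof -
  define f1 where "f1 z = trunc b t (Y (P1 (z $ 1)))" for z :: "real ^ 4"
  define f2 where "f2 z = trunc b t (Y (P2 (z $ 2)))" for z :: "real ^ 4"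
  define f3 where "f3 z = trunc l r (X (P3 (z $ 3)))" for z :: "real ^ 4"
  define f4 where "f4 z = trunc l r (X (P4 (z $ 4)))" for z :: "real ^ 4"
  define u where "u z = trunc b t (Y (midpoint (P3 (z $ 3)) (P4 (z $ 4))))" for z :: "real ^ 4"
  define v where "v z = trunc l r (X (midpoint (P1 (z $ 1)) (P2 (z $ 2))))" for z :: "real ^ 4"
  note defs = f1_def f2_def f3_def f4_def u_def v_def
  \<comment> \<open>The equations \<open>f1 = f2 = u\<close> are equivalent to \<open>2 * f1 - f2 - u = 0\<close> and \<open>2 * f2 - f1 - u = 0\<close>.
     At a start point \<open>f1\<close> is the largest possible value, and at an end point the smallest, so it
     dominates, or is dominated by, both \<open>f2\<close> and \<open>u\<close>; the same holds with \<open>f1\<close> and \<open>f2\<close> exchanged.\<close>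
  define F :: "real ^ 4 \<Rightarrow> real ^ 4" where
    "F z = (\<chi> i. if i = 1 then 2 * f1 z - f2 z - u z else if i = 2 then 2 * f2 z - f1 z - u z
                 else if i = 3 then 2 * f3 z - f4 z - v z else 2 * f4 z - f3 z - v z)" for z
  have F_nth: "F z $ 1 = 2 * f1 z - f2 z - u z" "F z $ 2 = 2 * f2 z - f1 z - u z"
    "F z $ 3 = 2 * f3 z - f4 z - v z" "F z $ 4 = 2 * f4 z - f3 z - v z" for z
    by (simp_all add: F_def)
  have comp: "continuous_on (cbox 0 1) (\<lambda>z. P (z $ i))"
    if "continuous_on {0..1} P" for P :: "real \<Rightarrow> 'a" and i :: 4
    by (rule continuous_on_compose2[OF that]) (auto intro!: continuous_intros simp: mem_box_cart)
  note contP = comp[OF cont(1)] comp[OF cont(2)] comp[OF cont(3)] comp[OF cont(4)]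
  have "continuous_on (cbox 0 1) (\<lambda>z. F z $ i)" for i
    unfolding F_def defs midpoint_def vec_lambda_beta
    by (cases "i = 1"; cases "i = 2"; cases "i = 3"; simp;
        intro continuous_intros contP continuous_on_compose2[OF cont(5)]
          continuous_on_compose2[OF cont(6)]; simp)
  then have "continuous_on (cbox 0 1) F"
    using continuous_on_vec_lambda[of "cbox 0 1" "\<lambda>i z. F z $ i"] by simp
  moreover have "0 \<le> F z $ i" if "z \<in> cbox 0 1" "z $ i = 0" for z i
  proof -
    have "f2 z \<le> f1 z" "u z \<le> f1 z" if "z $ 1 = 0"
      using that Y_start trunc_le_trunc by (auto simp: defs)
    moreover have "f1 z \<le> f2 z" "u z \<le> f2 z" if "z $ 2 = 0"
      using that Y_start trunc_le_trunc by (auto simp: defs)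
    moreover have "f4 z \<le> f3 z" "v z \<le> f3 z" if "z $ 3 = 0"
      using that X_start trunc_le_trunc by (auto simp: defs)
    moreover have "f3 z \<le> f4 z" "v z \<le> f4 z" if "z $ 4 = 0"
      using that X_start trunc_le_trunc by (auto simp: defs)
    ultimately show ?thesis
      using that exhaust_4[of i] by (auto simp: F_nth)
  qed
  moreover have "F z $ i \<le> 0" if "z \<in> cbox 0 1" "z $ i = 1" for z i
  proof -
    have "f1 z \<le> f2 z" "f1 z \<le> u z" if "z $ 1 = 1"
      using that Y_end trunc_ge_trunc by (auto simp: defs)
    moreover have "f2 z \<le> f1 z" "f2 z \<le> u z" if "z $ 2 = 1"
      using that Y_end trunc_ge_trunc by (auto simp: defs)
    moreover have "f3 z \<le> f4 z" "f3 z \<le> v z" if "z $ 3 = 1"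
      using that X_end trunc_ge_trunc by (auto simp: defs)
    moreover have "f4 z \<le> f3 z" "f4 z \<le> v z" if "z $ 4 = 1"
      using that X_end trunc_ge_trunc by (auto simp: defs)
    ultimately show ?thesis
      using that exhaust_4[of i] by (auto simp: F_nth)
  qed
  ultimately obtain z where z: "z \<in> cbox 0 1" "F z = 0"
    by (rule poincare_miranda)
  then have "2 * f1 z - f2 z - u z = 0" "2 * f2 z - f1 z - u z = 0"
    "2 * f3 z - f4 z - v z = 0" "2 * f4 z - f3 z - v z = 0"
    using F_nth[of z] by simp_all
  then have "f1 z = u z" "f2 z = u z" "f3 z = v z" "f4 z = v z"
    by linarith+
  with z(1) show thesis
    unfolding defs by (rule that)
qed

section \<open>Paths across a Jordan curve that meet only at strict extremes\<close>

definition strictly_extremal :: "('a \<Rightarrow> real) \<Rightarrow> 'a set \<Rightarrow> 'a \<Rightarrow> bool" where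
  "strictly_extremal h S z \<longleftrightarrow> (\<forall>w\<in>S - {z}. h w < h z) \<or> (\<forall>w\<in>S - {z}. h z < h w)"

lemma jordan_curve_loop:
  assumes "jordan_curve \<gamma>" "T \<in> curve_image \<gamma>"
  obtains c :: "real \<Rightarrow> plane" where "continuous_on {0..1} c" "c ` {0..1} = curve_image \<gamma>"
    "c 0 = T" "c 1 = T"
    "\<And>x y. x \<in> {0..1} \<Longrightarrow> y \<in> {0..1} \<Longrightarrow> c x = c y \<Longrightarrow> x = y \<or> {x, y} = {0, 1}"
proof -
  obtain z0 where z0: "norm z0 = 1" "\<gamma> z0 = T"
    using assms(2) by (auto simp: curve_image_def)
  define e where "e x = z0 * cis (2 * pi * x)" for x
  define c where "c x = \<gamma> (e x)" for x
  have cont: "continuous_on (sphere 0 1) \<gamma>" and inj: "inj_on \<gamma> (sphere 0 1)"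
    using assms(1) by (auto simp: jordan_curve_def)
  have e_sphere: "e x \<in> sphere 0 1" for x
    by (simp add: e_def norm_mult z0)
  have "continuous_on {0..1} e"
    unfolding e_def by (intro continuous_intros)
  then have "continuous_on {0..1} c"
    unfolding c_def using e_sphere by (intro continuous_on_compose2[OF cont]) auto
  moreover have "c ` {0..1} = curve_image \<gamma>"
  proof -
    have "w \<in> e ` {0..1}" if "norm w = 1" for w
    proof -
      have n: "norm (w / z0) = 1"
        using that z0 by (simp add: norm_divide)
      have "cis (Arg2pi (w / z0)) = w / z0"
        using n Arg2pi_eq[of "w / z0"] by (simp add: cis_conv_exp)
      then have "e (Arg2pi (w / z0) / (2 * pi)) = w"
        using z0 by (auto simp: e_def)
      moreover have "Arg2pi (w / z0) / (2 * pi) \<in> {0..1}"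
        using Arg2pi_ge_0[of "w / z0"] Arg2pi_lt_2pi[of "w / z0"] by (auto simp: field_simps)
      ultimately show ?thesis by (metis imageI)
    qed
    then have "e ` {0..1} = sphere 0 1"
      using e_sphere by auto
    then show ?thesis
      by (metis (no_types, lifting) c_def curve_image_def image_cong image_image)
  qed
  moreover have "c 0 = T" "c 1 = T"
    by (simp_all add: c_def e_def z0)
  moreover have "x = y \<or> {x, y} = {0, 1}" if "x \<in> {0..1}" "y \<in> {0..1}" "c x = c y" for x y
  proof -
    have "e x = e y"
      using that inj e_sphere unfolding c_def by (meson inj_onD)
    then have "cis (2 * pi * x) = cis (2 * pi * y)"
      using z0 by (auto simp: e_def)
    then obtain n :: int where "2 * pi * x = 2 * pi * y + 2 * pi * n"
      using sin_cos_eq_iff[of "2 * pi * x" "2 * pi * y"] by (auto simp: complex_eq_iff)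
    then have "2 * pi * x = 2 * pi * (y + n)"
      by (simp add: algebra_simps)
    then have n: "x = y + n"
      by simp
    then have "-1 \<le> n" "n \<le> 1"
      using that by auto
    then have "n = -1 \<or> n = 0 \<or> n = 1"
      by linarith
    then show ?thesis
      using n that by auto
  qed
  ultimately show thesis
    by (rule that)
qed

text \<open>\<open>P\<close> runs within \<open>S\<close> from a maximum to a minimum of \<open>h\<close> on \<open>S\<close>; in between \<open>h\<close> need not decrease.\<close>

definition full_descent :: "('a::topological_space \<Rightarrow> real) \<Rightarrow> 'a set \<Rightarrow> (real \<Rightarrow> 'a) \<Rightarrow> bool" where
  "full_descent h S P \<longleftrightarrow> continuous_on {0..1} P \<and> P ` {0..1} \<subseteq> S \<and>
     (\<forall>w\<in>S. h (P 1) \<le> h w \<and> h w \<le> h (P 0))"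

lemma full_descentD:
  assumes "full_descent h S P"
  shows "continuous_on {0..1} P" "P ` {0..1} \<subseteq> S"
    "\<And>w. w \<in> S \<Longrightarrow> h (P 1) \<le> h w" "\<And>w. w \<in> S \<Longrightarrow> h w \<le> h (P 0)"
  using assms by (auto simp: full_descent_def)

text \<open>Run through the curve as a loop \<open>c\<close> from a highest point \<open>T\<close> back to \<open>T\<close>. Choose two lowest
  points \<open>c b\<close> and \<open>c b'\<close> with \<open>b \<le> b'\<close>, distinct unless there is only one. The two descents go from
  \<open>0\<close> up to \<open>b\<close> and from \<open>1\<close> down to \<open>b'\<close>. They share a lowest point only if it is unique, and
  they share \<open>T\<close>. If there is another highest point, one of the descents is made to start there
  instead, which separates them at the top.\<close>

lemma full_descents_meeting_at_extremes:
  fixes h :: "plane \<Rightarrow> real"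
  assumes jordan: "jordan_curve \<gamma>" and cont_h: "continuous_on UNIV h"
    and nonconst: "\<exists>z\<in>curve_image \<gamma>. \<exists>w\<in>curve_image \<gamma>. h z \<noteq> h w"
  obtains P Q where "full_descent h (curve_image \<gamma>) P" "full_descent h (curve_image \<gamma>) Q"
    "\<forall>z \<in> P ` {0..1} \<inter> Q ` {0..1}. strictly_extremal h (curve_image \<gamma>) z"
proof -
  let ?J = "curve_image \<gamma>"
  have "compact ?J" "?J \<noteq> {}"
    using jordan nonconst
    by (auto simp: jordan_curve_def curve_image_def intro!: compact_continuous_image)
  moreover have "continuous_on ?J h"
    using cont_h continuous_on_subset by blast
  ultimately obtain T B where T: "T \<in> ?J" "\<And>w. w \<in> ?J \<Longrightarrow> h w \<le> h T"
    and B: "B \<in> ?J" "\<And>w. w \<in> ?J \<Longrightarrow> h B \<le> h w"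
    by (metis continuous_attains_inf continuous_attains_sup)
  have BT: "h B < h T"
    using nonconst T(2) B(2) by (metis linorder_neqE_linordered_idom not_less order_trans)
  obtain c where c: "continuous_on {0..1} c" "c ` {0..1} = ?J" "c 0 = T" "c 1 = T"
    and inj: "\<And>x y. x \<in> {0..1} \<Longrightarrow> y \<in> {0..1} \<Longrightarrow> c x = c y \<Longrightarrow> x = y \<or> {x, y} = {0, 1::real}"
    using jordan_curve_loop[OF jordan T(1)] by metis
  have "\<exists>b\<in>{0..1}. \<exists>b'\<in>{0..1}. h (c b) = h B \<and> h (c b') = h B \<and> b \<le> b' \<and>
      (b = b' \<longrightarrow> (\<forall>x\<in>{0..1}. h (c x) = h B \<longrightarrow> x = b))"
  proof -
    obtain b0 where b0: "b0 \<in> {0..1}" "c b0 = B"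
      using B(1) c(2) by (metis imageE)
    show ?thesis
    proof (cases "\<forall>x\<in>{0..1}. h (c x) = h B \<longrightarrow> x = b0")
      case True
      with b0 show ?thesis by blast
    next
      case False
      then obtain b1 where "b1 \<in> {0..1}" "h (c b1) = h B" "b1 \<noteq> b0"
        by blast
      with b0 show ?thesis
        by (metis linorder_le_cases)
    qed
  qed
  then obtain b b' where b: "b \<in> {0..1}" "b' \<in> {0..1}" "h (c b) = h B" "h (c b') = h B" "b \<le> b'"
    and b_unique: "b = b' \<Longrightarrow> x \<in> {0..1} \<Longrightarrow> h (c x) = h B \<Longrightarrow> x = b" for x
    by metis
  have b_pos: "0 < b" "b' < 1"
    using b BT c(3,4) by (metis atLeastAtMost_iff less_irrefl less_le)+
  \<comment> \<open>One path stays in \<open>{0..b}\<close> and the other in \<open>{b..1}\<close>, so they can only share the point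
     at \<open>b\<close> and, since \<open>c 0 = c 1\<close>, the point \<open>T\<close>.\<close>
  have "\<exists>a\<in>{0..1}. \<exists>a'\<in>{0..1}. h (c a) = h T \<and> h (c a') = h T \<and>
      closed_segment a b \<subseteq> {0..b} \<and> closed_segment a' b' \<subseteq> {b..1} \<and>
      (b \<in> closed_segment a' b' \<longrightarrow> b = b') \<and>
      (0 \<in> closed_segment a b \<and> 1 \<in> closed_segment a' b' \<longrightarrow> (\<forall>w\<in>?J. h w = h T \<longrightarrow> w = T))"
  proof (cases "\<forall>w\<in>?J. h w = h T \<longrightarrow> w = T")
    case True
    then show ?thesis
      using b b_pos c(3,4)
      by (intro bexI[of _ 0] bexI[of _ 1]) (auto simp: closed_segment_eq_real_ivl)
  next
    case False
    then obtain t where t: "t \<in> {0..1}" "h (c t) = h T" "c t \<noteq> T"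
      using c(2) by (metis imageE)
    then have t': "0 < t" "t < 1" "t \<noteq> b"
      using c(3,4) b(3) BT by (auto simp: less_le)
    show ?thesis
    \<comment> \<open>The second highest point replaces the start on its side of \<open>b\<close>. Beyond \<open>b\<close> it may lie before
       or after \<open>b'\<close>, so that path runs through the parameters in either direction.\<close>
    proof (cases "t < b")
      case True
      then show ?thesis
        using b b_pos c(4) t t'
        by (intro bexI[of _ t] bexI[of _ 1]) (auto simp: closed_segment_eq_real_ivl)
    next
      case False
      then show ?thesis
        using b b_pos c(3) t t'
        by (intro bexI[of _ 0] bexI[of _ t]) (auto simp: closed_segment_eq_real_ivl split: if_splits)
    qed
  qed
  then obtain a a' where a: "a \<in> {0..1}" "a' \<in> {0..1}" "h (c a) = h T" "h (c a') = h T"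
    and seg: "closed_segment a b \<subseteq> {0..b}" "closed_segment a' b' \<subseteq> {b..1}"
    and b_in: "b \<in> closed_segment a' b' \<Longrightarrow> b = b'"
    and T_unique: "0 \<in> closed_segment a b \<Longrightarrow> 1 \<in> closed_segment a' b' \<Longrightarrow>
      w \<in> ?J \<Longrightarrow> h w = h T \<Longrightarrow> w = T" for w
    by metis
  have seg01: "closed_segment a b \<subseteq> {0..1}" "closed_segment a' b' \<subseteq> {0..1}"
    using seg b by auto
  have arc: "continuous_on {0..1} (\<lambda>s. c (linepath x y s))"
      "(\<lambda>s. c (linepath x y s)) ` {0..1} = c ` closed_segment x y"
    if "closed_segment x y \<subseteq> {0..1}" for x y
  proof -
    show "continuous_on {0..1} (\<lambda>s. c (linepath x y s))"
      using that linepath_in_path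
      by (intro continuous_on_compose2[OF c(1)] continuous_on_linepath) blast
    show "(\<lambda>s. c (linepath x y s)) ` {0..1} = c ` closed_segment x y"
      unfolding linepath_image_01[symmetric] image_image ..
  qed
  have arc_J: "c ` closed_segment a b \<subseteq> ?J" "c ` closed_segment a' b' \<subseteq> ?J"
    using seg01 c(2) by blast+
  have ends: "linepath x y 0 = x" "linepath x y 1 = y" for x y :: real
    by (simp_all add: linepath_def)
  have "full_descent h ?J (\<lambda>s. c (linepath a b s))" "full_descent h ?J (\<lambda>s. c (linepath a' b' s))"
    by (simp_all add: full_descent_def ends a b T(2) B(2) arc[OF seg01(1)] arc[OF seg01(2)] arc_J)
  then show thesis
  proof (rule that, intro ballI)
    fix z
    assume "z \<in> (\<lambda>s. c (linepath a b s)) ` {0..1} \<inter> (\<lambda>s. c (linepath a' b' s)) ` {0..1}"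
    then obtain u v where uv: "u \<in> closed_segment a b" "v \<in> closed_segment a' b'" "z = c u" "z = c v"
      unfolding arc[OF seg01(1)] arc[OF seg01(2)] by blast
    then consider "u = v" | "{u, v} = {0, 1}"
      using inj[of u v] seg01 by (metis subsetD)
    then show "strictly_extremal h ?J z"
    proof cases
      case 1
      have "u \<in> {0..b}" "v \<in> {b..1}"
        using uv seg by blast+
      then have "u = b" "b \<in> closed_segment a' b'"
        using uv(2) 1 by auto
      then have "h z = h B" "b = b'"
        using uv b b_in by auto
      then have "h z < h w" if "w \<in> ?J - {z}" for w
        using that B(2) b_unique uv c(2) \<open>u = b\<close> by (metis Diff_iff imageE insertI1 less_le)
      then show ?thesis
        by (auto simp: strictly_extremal_def)
    next
      case 2
      then have "u = 0" "v = 1"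
        using uv seg b b_pos by (auto simp: subset_iff doubleton_eq_iff)
      then have "z = T" and "h w < h T" if "w \<in> ?J - {T}" for w
        using that uv c T(2) T_unique by (auto simp: less_le)
      then show ?thesis
        using uv c \<open>u = 0\<close> by (auto simp: strictly_extremal_def)
    qed
  qed
qed

section \<open>Rotated coordinates and rhombi\<close>

text \<open>The functional whose level sets are the lines of angle \<open>\<theta>\<close>. Together with
  \<open>coord (\<theta> + pi / 2)\<close> it forms an orthonormal coordinate system.\<close>

definition coord :: "real \<Rightarrow> plane \<Rightarrow> real" where
  "coord \<theta> p = p $ 1 * sin \<theta> - p $ 2 * cos \<theta>"

lemma coord_right_angle: "coord (\<theta> + pi / 2) p = p $ 1 * cos \<theta> + p $ 2 * sin \<theta>"
  by (simp add: coord_def sin_add cos_add)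

lemma coord_midpoint: "coord \<theta> (midpoint p q) = (coord \<theta> p + coord \<theta> q) / 2"
  by (simp add: coord_def midpoint_def field_simps)

lemma continuous_on_coord: "continuous_on S (coord \<theta>)"
  unfolding coord_def by (intro continuous_intros)

lemma dist_coord: "(dist p q)\<^sup>2 = (coord \<theta> p - coord \<theta> q)\<^sup>2 +
    (coord (\<theta> + pi / 2) p - coord (\<theta> + pi / 2) q)\<^sup>2"
proof -
  define a b where "a = p $ 1 - q $ 1" and "b = p $ 2 - q $ 2"
  have "(dist p q)\<^sup>2 = a\<^sup>2 + b\<^sup>2"
    by (simp add: dist_vec_def L2_set_def sum_2 dist_real_def a_def b_def)
  also have "\<dots> = (a\<^sup>2 + b\<^sup>2) * ((sin \<theta>)\<^sup>2 + (cos \<theta>)\<^sup>2)"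
    by simp
  also have "\<dots> = (a * sin \<theta> - b * cos \<theta>)\<^sup>2 + (a * cos \<theta> + b * sin \<theta>)\<^sup>2"
    by algebra
  finally show ?thesis
    unfolding coord_right_angle unfolding coord_def a_def b_def by (simp add: algebra_simps)
qed

lemma coord_eqI:
  "coord \<theta> p = coord \<theta> q \<Longrightarrow> coord (\<theta> + pi / 2) p = coord (\<theta> + pi / 2) q \<Longrightarrow> p = q"
  using dist_coord[of p q \<theta>] by simp

lemma line_of_angle_coord: "line_of_angle \<theta> L \<longleftrightarrow> (\<exists>c. L = {p. coord \<theta> p = c})"
  by (simp add: line_of_angle_def coord_def)

text \<open>If one coordinate were constant, the other one would embed a circle into the line; but a
  continuous real function on the circle agrees at some pair of antipodal points.\<close>

lemma coord_nonconstant: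
  assumes "jordan_curve \<gamma>"
  shows "\<exists>z\<in>curve_image \<gamma>. \<exists>w\<in>curve_image \<gamma>. coord \<theta> z \<noteq> coord \<theta> w"
proof (rule ccontr)
  assume "\<not> ?thesis"
  then have const: "coord \<theta> (\<gamma> z) = coord \<theta> (\<gamma> w)" if "norm z = 1" "norm w = 1" for z w
    using that unfolding curve_image_def by (metis imageI mem_sphere_0)
  \<comment> \<open>\<open>g z - g (- z)\<close> is odd in \<open>z\<close>, hence vanishes somewhere on the connected circle.\<close>
  define g where "g z = coord (\<theta> + pi / 2) (\<gamma> z)" for z
  have cont: "continuous_on (sphere 0 1) \<gamma>" and inj: "inj_on \<gamma> (sphere 0 1)"
    using assms by (auto simp: jordan_curve_def)
  have "continuous_on (sphere 0 1) g"
    unfolding g_def by (rule continuous_on_compose2[OF continuous_on_coord[of UNIV] cont]) simp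
  moreover have "continuous_on (sphere 0 1) (\<lambda>z. g (- z))"
    by (rule continuous_on_compose2[OF calculation]) (auto intro!: continuous_intros)
  ultimately have "continuous_on (sphere 0 1) (\<lambda>z. g z - g (- z))"
    by (rule continuous_on_diff)
  moreover have "connected (sphere 0 1 :: complex set)"
    by (simp add: connected_sphere)
  ultimately have conn: "connected ((\<lambda>z. g z - g (- z)) ` sphere 0 1)"
    by (rule connected_continuous_image)
  have mem: "g 1 - g (- 1) \<in> (\<lambda>z. g z - g (- z)) ` sphere 0 1"
    "g (- 1) - g 1 \<in> (\<lambda>z. g z - g (- z)) ` sphere 0 1"
    by (force intro: image_eqI[where x = 1], force intro: image_eqI[where x = "-1"])
  have "0 \<in> (\<lambda>z. g z - g (- z)) ` sphere 0 1"
    by (cases "g 1 \<le> g (- 1)")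
      (rule connectedD_interval[OF conn mem] connectedD_interval[OF conn mem(2,1)]; linarith)+
  then obtain z where z: "norm z = 1" "g z = g (- z)"
    by auto
  then have "\<gamma> z = \<gamma> (- z)"
    using const[of z "- z"] unfolding g_def by (auto intro: coord_eqI)
  then have "z = - z"
    using inj z(1) by (auto dest: inj_onD)
  with z(1) show False
    by auto
qed

text \<open>A strict extreme value cannot be averaged from other values. This is what turns a chord of
  length zero into a special corner.\<close>

lemma strictly_extremal_average:
  assumes "strictly_extremal h S z" "a \<in> S" "b \<in> S" "h a + h b = 2 * h z"
  shows "a = z" "b = z"
proof -
  have "(a = z \<or> h a < h z) \<and> (b = z \<or> h b < h z) \<or>
      (a = z \<or> h z < h a) \<and> (b = z \<or> h z < h b)"
    using assms(1-3) by (auto simp: strictly_extremal_def)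
  with assms(4) show "a = z" "b = z"
    by auto
qed

lemma strictly_extremal_level:
  "strictly_extremal h S z \<Longrightarrow> w \<in> S \<Longrightarrow> h w = h z \<Longrightarrow> w = z"
  using strictly_extremal_average[of h S z w w] by simp

lemma special_corner_of_angle_coord:
  "special_corner_of_angle \<gamma> \<theta> p \<longleftrightarrow> p \<in> curve_image \<gamma> \<and>
     (\<forall>w\<in>curve_image \<gamma>. coord \<theta> w = coord \<theta> p \<longrightarrow> w = p) \<and>
     (\<forall>w\<in>curve_image \<gamma>. coord (\<theta> + pi / 2) w = coord (\<theta> + pi / 2) p \<longrightarrow> w = p)"
  (is "_ \<longleftrightarrow> ?rhs")
proof
  assume "special_corner_of_angle \<gamma> \<theta> p"
  then obtain c d where "p \<in> curve_image \<gamma>" "coord \<theta> p = c" "coord (\<theta> + pi / 2) p = d"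
    and "{w. coord \<theta> w = c} \<inter> curve_image \<gamma> = {p}"
    and "{w. coord (\<theta> + pi / 2) w = d} \<inter> curve_image \<gamma> = {p}"
    unfolding special_corner_of_angle_def line_of_angle_coord by blast
  then show ?rhs
    by blast
next
  assume rhs: ?rhs
  then have "{w. coord \<theta> w = coord \<theta> p} \<inter> curve_image \<gamma> = {p}"
    "{w. coord (\<theta> + pi / 2) w = coord (\<theta> + pi / 2) p} \<inter> curve_image \<gamma> = {p}"
    by blast+
  with rhs show "special_corner_of_angle \<gamma> \<theta> p"
    unfolding special_corner_of_angle_def line_of_angle_coord by blast
qed

lemma closed_segment_subset_level:
  assumes "coord \<theta> p = coord \<theta> q"
  shows "closed_segment p q \<subseteq> {w. coord \<theta> w = coord \<theta> p}"
proof
  fix w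
  assume "w \<in> closed_segment p q"
  then obtain u where w: "w = (1 - u) *\<^sub>R p + u *\<^sub>R q"
    by (auto simp: in_segment)
  have "coord \<theta> w = (1 - u) * coord \<theta> p + u * coord \<theta> q"
    unfolding coord_def w by (simp add: algebra_simps)
  with assms show "w \<in> {w. coord \<theta> w = coord \<theta> p}"
    by (simp add: algebra_simps)
qed

text \<open>A parallelogram with perpendicular diagonals is a rhombus.\<close>

lemma rhombus_of_chords:
  assumes mid: "midpoint p q = midpoint r s" and ne: "p \<noteq> q" "r \<noteq> s"
    and Y: "coord \<theta> p = coord \<theta> q" and X: "coord (\<theta> + pi / 2) r = coord (\<theta> + pi / 2) s"
  shows "rhombus_of_angle \<theta> p r q s"
proof -
  let ?Y = "coord \<theta>" and ?X = "coord (\<theta> + pi / 2)"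
  have sums: "?Y r + ?Y s = 2 * ?Y p" "?X p + ?X q = 2 * ?X r"
    using arg_cong[OF mid, of ?Y] arg_cong[OF mid, of ?X] X Y by (simp_all add: coord_midpoint)
  have ne': "w \<noteq> v" if "w \<in> {p, q}" "v \<in> {r, s}" for w v
  proof
    assume "w = v"
    with that sums X Y have "?Y r = ?Y s"
      by auto
    with X ne show False
      using coord_eqI by blast
  qed
  have Yrs: "?Y s = 2 * ?Y p - ?Y r" and Xpq: "?X q = 2 * ?X r - ?X p"
    using sums by auto
  have "(dist w v)\<^sup>2 = (?Y p - ?Y r)\<^sup>2 + (?X p - ?X r)\<^sup>2" if "w \<in> {p, q}" "v \<in> {r, s}" for w v
    using that X[symmetric] Y[symmetric] unfolding dist_coord[of w v \<theta>]
    by (auto simp: Yrs Xpq power2_eq_square algebra_simps)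
  then have "(dist p r)\<^sup>2 = (dist w v)\<^sup>2" if "w \<in> {p, q}" "v \<in> {r, s}" for w v
    using that by (metis insertI1)
  then have sides: "dist p r = dist w v" if "w \<in> {p, q}" "v \<in> {r, s}" for w v
    using that by (metis power2_eq_imp_eq zero_le_dist)
  have "dist p r = dist q r" "dist p r = dist q s" "dist p r = dist p s"
    by (rule sides; simp)+
  then have "dist p r = dist r q \<and> dist r q = dist q s \<and> dist q s = dist s p"
    by (metis dist_commute)
  moreover have "distinct [p, r, q, s]"
    using ne ne'[of p r] ne'[of p s] ne'[of q r] ne'[of q s] by auto
  ultimately have "rhombus p r q s"
    by (simp only: rhombus_def)
  then show ?thesis
    unfolding rhombus_of_angle_def line_of_angle_coord
    using closed_segment_subset_level[OF Y] closed_segment_subset_level[OF X] by blast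
qed

section \<open>Rhombi at all angles near an angle without special corners\<close>

lemma tendsto_coord:
  assumes "(\<phi> \<longlongrightarrow> \<theta>) F" "(p \<longlongrightarrow> q) F"
  shows "((\<lambda>n. coord (\<phi> n) (p n)) \<longlongrightarrow> coord \<theta> q) F"
proof -
  have "((\<lambda>n. sin (\<phi> n)) \<longlongrightarrow> sin \<theta>) F" "((\<lambda>n. cos (\<phi> n)) \<longlongrightarrow> cos \<theta>) F"
    using isCont_tendsto_compose[OF _ assms(1), of sin] isCont_tendsto_compose[OF _ assms(1), of cos]
    by simp_all
  then show ?thesis
    unfolding coord_def by (intro tendsto_diff tendsto_mult tendsto_vec_nth assms(2))
qed

lemma eventually_less_of_tendsto:
  fixes f g :: "'a \<Rightarrow> real"
  assumes "(f \<longlongrightarrow> a) F" "(g \<longlongrightarrow> b) F" "a < b"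
  shows "eventually (\<lambda>n. f n < g n) F"
  using order_tendstoD(1)[OF tendsto_diff[OF assms(2,1)], of 0] assms(3) by simp

text \<open>If \<open>p = q\<close>, then this point is strictly extremal in \<open>Y\<close> and its \<open>Y\<close>-value is the average of
  those of \<open>r\<close> and \<open>s\<close>, so \<open>r\<close> and \<open>s\<close> coincide with it. The point is then strictly
  extremal in \<open>X\<close> as well, which is excluded. A collapse of \<open>r\<close> and \<open>s\<close> forces
  \<open>p = q\<close> in the same way.\<close>

lemma midpoint_chords_nondegenerate:
  assumes J: "p \<in> J" "q \<in> J" "r \<in> J" "s \<in> J"
    and no_corner: "\<forall>w\<in>J. \<not> (strictly_extremal (coord \<theta>) J w \<and>
      strictly_extremal (coord (\<theta> + pi / 2)) J w)"
    and pq: "p = q \<longrightarrow> strictly_extremal (coord \<theta>) J p"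
    and rs: "r = s \<longrightarrow> strictly_extremal (coord (\<theta> + pi / 2)) J r"
    and Y: "coord \<theta> p = coord \<theta> q" "coord \<theta> r + coord \<theta> s = 2 * coord \<theta> p"
    and X: "coord (\<theta> + pi / 2) r = coord (\<theta> + pi / 2) s"
      "coord (\<theta> + pi / 2) p + coord (\<theta> + pi / 2) q = 2 * coord (\<theta> + pi / 2) r"
  shows "p \<noteq> q" "r \<noteq> s"
proof -
  show "p \<noteq> q"
  proof
    assume "p = q"
    then have "r = p" "s = p"
      using strictly_extremal_average[OF _ J(3,4) Y(2)] pq by auto
    then show False
      using no_corner pq rs J \<open>p = q\<close> by auto
  qed
  moreover have "p = r \<and> q = r" if "r = s"
    using strictly_extremal_average[OF _ J(1,2) X(2)] rs that by auto
  ultimately show "r \<noteq> s"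
    by auto
qed

text \<open>The paths are fixed by \<open>\<theta>\<close>. For angles \<open>\<phi> n\<close> tending to \<open>\<theta>\<close> that violate the claim,
  \<open>chord_crossing\<close> gives truncated solutions \<open>z n\<close>, and compactness a limit \<open>y\<close>. At \<open>\<theta>\<close>
  the curve lies within the range of truncation, so \<open>y\<close> solves the exact equations, and
  it does not degenerate. Both conditions that make \<open>z n\<close> a rhombus are open, so they already hold
  for some \<open>z n\<close>.\<close>

lemma rhombi_near_cornerless_angle:
  assumes jordan: "jordan_curve \<gamma>" and cornerless: "\<nexists>p. special_corner_of_angle \<gamma> \<theta> p"
  shows "\<exists>\<epsilon>>0. \<forall>\<phi>. \<bar>\<phi> - \<theta>\<bar> < \<epsilon> \<longrightarrow> (\<exists>R. inscribed_rhombus_of_angle \<gamma> \<phi> R)"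
proof (rule ccontr)
  let ?J = "curve_image \<gamma>" and ?Y = "coord \<theta>" and ?X = "coord (\<theta> + pi / 2)"
  assume neg: "\<not> ?thesis"
  have "\<exists>\<phi>. \<bar>\<phi> - \<theta>\<bar> < inverse (real (Suc n)) \<and> (\<nexists>R. inscribed_rhombus_of_angle \<gamma> \<phi> R)" for n
    using neg inverse_positive_iff_positive[of "real (Suc n)"] by (metis of_nat_0_less_iff zero_less_Suc)
  then obtain \<phi> where \<phi>: "\<bar>\<phi> n - \<theta>\<bar> < inverse (real (Suc n))"
    and none: "\<not> inscribed_rhombus_of_angle \<gamma> (\<phi> n) R" for n R
    by metis
  have "(\<lambda>n. \<phi> n - \<theta>) \<longlonglongrightarrow> 0"
    by (rule tendsto_rabs_zero_cancel,
        rule real_tendsto_sandwich[OF _ _ tendsto_const LIMSEQ_inverse_real_of_nat])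
      (use \<phi> in \<open>auto intro!: always_eventually less_imp_le simp del: of_nat_Suc\<close>)
  then have \<phi>_lim: "\<phi> \<longlonglongrightarrow> \<theta>"
    by (simp add: LIM_zero_iff)
  obtain P1 P2 where P12: "full_descent ?Y ?J P1" "full_descent ?Y ?J P2"
    and P_meet: "\<forall>w \<in> P1 ` {0..1} \<inter> P2 ` {0..1}. strictly_extremal ?Y ?J w"
    by (rule full_descents_meeting_at_extremes[OF jordan continuous_on_coord coord_nonconstant[OF jordan]])
  obtain P3 P4 where P34: "full_descent ?X ?J P3" "full_descent ?X ?J P4"
    and Q_meet: "\<forall>w \<in> P3 ` {0..1} \<inter> P4 ` {0..1}. strictly_extremal ?X ?J w"
    by (rule full_descents_meeting_at_extremes[OF jordan continuous_on_coord coord_nonconstant[OF jordan]])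
  note P_cont = P12[THEN full_descentD(1)] P34[THEN full_descentD(1)]
  note P_image = P12[THEN full_descentD(2)] P34[THEN full_descentD(2)]
  \<comment> \<open>Bounds that the fixed paths reach on both ends in the coordinates of angle \<open>\<psi>\<close>. At \<open>\<psi> = \<theta>\<close> they are
     the extreme values on the whole curve.\<close>
  define t where "t \<psi> = min (coord \<psi> (P1 0)) (coord \<psi> (P2 0))" for \<psi>
  define b where "b \<psi> = max (coord \<psi> (P1 1)) (coord \<psi> (P2 1))" for \<psi>
  define r where "r \<psi> = min (coord (\<psi> + pi / 2) (P3 0)) (coord (\<psi> + pi / 2) (P4 0))" for \<psi>
  define l where "l \<psi> = max (coord (\<psi> + pi / 2) (P3 1)) (coord (\<psi> + pi / 2) (P4 1))" for \<psi>
  define p1 where "p1 z = P1 (z $ 1)" for z :: "real ^ 4"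
  define p2 where "p2 z = P2 (z $ 2)" for z :: "real ^ 4"
  define p3 where "p3 z = P3 (z $ 3)" for z :: "real ^ 4"
  define p4 where "p4 z = P4 (z $ 4)" for z :: "real ^ 4"
  note p_defs = p1_def p2_def p3_def p4_def
  define solves where "solves \<psi> z \<longleftrightarrow>
      trunc (b \<psi>) (t \<psi>) (coord \<psi> (p1 z)) = trunc (b \<psi>) (t \<psi>) (coord \<psi> (midpoint (p3 z) (p4 z))) \<and>
      trunc (b \<psi>) (t \<psi>) (coord \<psi> (p2 z)) = trunc (b \<psi>) (t \<psi>) (coord \<psi> (midpoint (p3 z) (p4 z))) \<and>
      trunc (l \<psi>) (r \<psi>) (coord (\<psi> + pi / 2) (p3 z)) =
        trunc (l \<psi>) (r \<psi>) (coord (\<psi> + pi / 2) (midpoint (p1 z) (p2 z))) \<and>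
      trunc (l \<psi>) (r \<psi>) (coord (\<psi> + pi / 2) (p4 z)) =
        trunc (l \<psi>) (r \<psi>) (coord (\<psi> + pi / 2) (midpoint (p1 z) (p2 z)))" for \<psi> z
  have "\<exists>z \<in> cbox 0 1. solves \<psi> z" for \<psi>
    unfolding p_defs solves_def
    by (rule chord_crossing[OF P_cont continuous_on_coord continuous_on_coord,
          of "t \<psi>" \<psi> "b \<psi>" "r \<psi>" "\<psi> + pi / 2" "l \<psi>"])
      (auto simp: t_def b_def r_def l_def)
  then have "\<forall>n. \<exists>z. z \<in> cbox 0 1 \<and> solves (\<phi> n) z"
    by blast
  from choice[OF this] obtain z
    where z: "z n \<in> cbox 0 1" and solves_z: "solves (\<phi> n) (z n)" for n :: nat
    by blast
  note eqs = solves_z[unfolded solves_def, THEN conjunct1]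
    solves_z[unfolded solves_def, THEN conjunct2, THEN conjunct1]
    solves_z[unfolded solves_def, THEN conjunct2, THEN conjunct2, THEN conjunct1]
    solves_z[unfolded solves_def, THEN conjunct2, THEN conjunct2, THEN conjunct2]
  obtain y \<sigma> where y: "y \<in> cbox 0 1" and \<sigma>: "strict_mono (\<sigma> :: nat \<Rightarrow> nat)" and "(z \<circ> \<sigma>) \<longlonglongrightarrow> y"
    using compact_imp_seq_compact[OF compact_cbox] z unfolding seq_compact_def by metis
  then have z_lim: "(\<lambda>n. z (\<sigma> n)) \<longlonglongrightarrow> y"
    by (simp add: o_def)
  define \<psi> where "\<psi> n = \<phi> (\<sigma> n)" for n
  have \<psi>: "\<psi> \<longlonglongrightarrow> \<theta>" "(\<lambda>n. \<psi> n + pi / 2) \<longlonglongrightarrow> \<theta> + pi / 2"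
    using LIMSEQ_subseq_LIMSEQ[OF \<phi>_lim \<sigma>] unfolding \<psi>_def by (auto simp: o_def intro!: tendsto_intros)
  have in01: "w $ i \<in> {0..1}" if "w \<in> cbox 0 1" for w :: "real ^ 4" and i
    using that by (simp add: mem_box_cart)
  have lim_path: "(\<lambda>n. R (z (\<sigma> n) $ i)) \<longlonglongrightarrow> R (y $ i)"
    if "continuous_on {0..1} R" for R :: "real \<Rightarrow> plane" and i
    by (rule continuous_on_tendsto_compose[OF that tendsto_vec_nth[OF z_lim]])
      (use in01 y z in auto)
  have lim: "(\<lambda>n. p1 (z (\<sigma> n))) \<longlonglongrightarrow> p1 y" "(\<lambda>n. p2 (z (\<sigma> n))) \<longlonglongrightarrow> p2 y"
      "(\<lambda>n. p3 (z (\<sigma> n))) \<longlonglongrightarrow> p3 y" "(\<lambda>n. p4 (z (\<sigma> n))) \<longlonglongrightarrow> p4 y"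
    unfolding p_defs by (intro lim_path P_cont)+
  have lim_mid: "(\<lambda>n. midpoint (p1 (z (\<sigma> n))) (p2 (z (\<sigma> n)))) \<longlonglongrightarrow> midpoint (p1 y) (p2 y)"
      "(\<lambda>n. midpoint (p3 (z (\<sigma> n))) (p4 (z (\<sigma> n)))) \<longlonglongrightarrow> midpoint (p3 y) (p4 y)"
    unfolding midpoint_def by (intro tendsto_intros lim)+
  note lim_Y = lim(1,2)[THEN tendsto_coord[OF \<psi>(1)]] lim_mid(2)[THEN tendsto_coord[OF \<psi>(1)]]
  note lim_X = lim(3,4)[THEN tendsto_coord[OF \<psi>(2)]] lim_mid(1)[THEN tendsto_coord[OF \<psi>(2)]]
  have lim_levels: "(\<lambda>n. t (\<psi> n)) \<longlonglongrightarrow> t \<theta>" "(\<lambda>n. b (\<psi> n)) \<longlonglongrightarrow> b \<theta>"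
      "(\<lambda>n. r (\<psi> n)) \<longlonglongrightarrow> r \<theta>" "(\<lambda>n. l (\<psi> n)) \<longlonglongrightarrow> l \<theta>"
    unfolding t_def b_def r_def l_def
    by (intro tendsto_min tendsto_max tendsto_coord tendsto_const \<psi>)+
  have in_J: "p1 w \<in> ?J" "p2 w \<in> ?J" "p3 w \<in> ?J" "p4 w \<in> ?J" if "w \<in> cbox 0 1" for w
    using P_image in01[OF that] unfolding p_defs by blast+
  note J = in_J[OF y]
  have Y_range: "b \<theta> \<le> ?Y w" "?Y w \<le> t \<theta>" and X_range: "l \<theta> \<le> ?X w" "?X w \<le> r \<theta>"
    if "w \<in> ?J" for w
    using that P12[THEN full_descentD(3)] P12[THEN full_descentD(4)]
      P34[THEN full_descentD(3)] P34[THEN full_descentD(4)]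
    by (auto simp: t_def b_def r_def l_def)
  have Y_mid: "b \<theta> \<le> ?Y (midpoint (p3 y) (p4 y))" "?Y (midpoint (p3 y) (p4 y)) \<le> t \<theta>"
    using Y_range[OF J(3)] Y_range[OF J(4)] by (auto simp: coord_midpoint)
  have X_mid: "l \<theta> \<le> ?X (midpoint (p1 y) (p2 y))" "?X (midpoint (p1 y) (p2 y)) \<le> r \<theta>"
    using X_range[OF J(1)] X_range[OF J(2)] by (auto simp: coord_midpoint)
  have "trunc (b \<theta>) (t \<theta>) (?Y (p1 y)) = trunc (b \<theta>) (t \<theta>) (?Y (midpoint (p3 y) (p4 y)))"
    "trunc (b \<theta>) (t \<theta>) (?Y (p2 y)) = trunc (b \<theta>) (t \<theta>) (?Y (midpoint (p3 y) (p4 y)))"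
    "trunc (l \<theta>) (r \<theta>) (?X (p3 y)) = trunc (l \<theta>) (r \<theta>) (?X (midpoint (p1 y) (p2 y)))"
    "trunc (l \<theta>) (r \<theta>) (?X (p4 y)) = trunc (l \<theta>) (r \<theta>) (?X (midpoint (p1 y) (p2 y)))"
    using lim_Y[THEN tendsto_trunc[OF lim_levels(2,1)]] lim_X[THEN tendsto_trunc[OF lim_levels(4,3)]]
    unfolding eqs[of "\<sigma> _", folded \<psi>_def] by (blast intro: LIMSEQ_unique)+
  then have Y_eq: "?Y (p1 y) = ?Y (midpoint (p3 y) (p4 y))" "?Y (p2 y) = ?Y (midpoint (p3 y) (p4 y))"
    and X_eq: "?X (p3 y) = ?X (midpoint (p1 y) (p2 y))" "?X (p4 y) = ?X (midpoint (p1 y) (p2 y))"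
    using Y_range J X_range Y_mid X_mid by (simp_all add: trunc_ident)
  have no_corner: "\<forall>w\<in>?J. \<not> (strictly_extremal ?Y ?J w \<and> strictly_extremal ?X ?J w)"
    using cornerless strictly_extremal_level unfolding special_corner_of_angle_coord by metis
  have "p1 y = p2 y \<longrightarrow> strictly_extremal ?Y ?J (p1 y)"
    using P_meet in01[OF y] unfolding p_defs by (metis IntI imageI)
  moreover have "p3 y = p4 y \<longrightarrow> strictly_extremal ?X ?J (p3 y)"
    using Q_meet in01[OF y] unfolding p_defs by (metis IntI imageI)
  moreover have "?Y (p1 y) = ?Y (p2 y)" "?Y (p3 y) + ?Y (p4 y) = 2 * ?Y (p1 y)"
    "?X (p3 y) = ?X (p4 y)" "?X (p1 y) + ?X (p2 y) = 2 * ?X (p3 y)"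
    using Y_eq X_eq by (simp_all add: coord_midpoint)
  ultimately have ne: "p1 y \<noteq> p2 y" "p3 y \<noteq> p4 y"
    by (rule midpoint_chords_nondegenerate[OF J no_corner])+
  \<comment> \<open>Two distinct points with equal \<open>X\<close> have different \<open>Y\<close>, so the \<open>Y\<close>-value of their midpoint is not
     extreme.\<close>
  have Y_strict: "b \<theta> < ?Y (midpoint (p3 y) (p4 y))" "?Y (midpoint (p3 y) (p4 y)) < t \<theta>"
  proof -
    have "?Y (p3 y) \<noteq> ?Y (p4 y)"
      using ne(2) X_eq coord_eqI by metis
    then show "b \<theta> < ?Y (midpoint (p3 y) (p4 y))" "?Y (midpoint (p3 y) (p4 y)) < t \<theta>"
      using Y_range[OF J(3)] Y_range[OF J(4)] by (auto simp: coord_midpoint)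
  qed
  have X_strict: "l \<theta> < ?X (midpoint (p1 y) (p2 y))" "?X (midpoint (p1 y) (p2 y)) < r \<theta>"
  proof -
    have "?X (p1 y) \<noteq> ?X (p2 y)"
      using ne(1) Y_eq coord_eqI by metis
    then show "l \<theta> < ?X (midpoint (p1 y) (p2 y))" "?X (midpoint (p1 y) (p2 y)) < r \<theta>"
      using X_range[OF J(1)] X_range[OF J(2)] by (auto simp: coord_midpoint)
  qed
  have "\<forall>\<^sub>F n in sequentially. p1 (z (\<sigma> n)) - p2 (z (\<sigma> n)) \<noteq> 0 \<and> p3 (z (\<sigma> n)) - p4 (z (\<sigma> n)) \<noteq> 0"
    using ne by (intro eventually_conj tendsto_imp_eventually_ne[OF tendsto_diff[OF lim(1,2)]]
      tendsto_imp_eventually_ne[OF tendsto_diff[OF lim(3,4)]]) auto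
  moreover have "\<forall>\<^sub>F n in sequentially. \<forall>w \<in> {p1 (z (\<sigma> n)), p2 (z (\<sigma> n)), midpoint (p3 (z (\<sigma> n))) (p4 (z (\<sigma> n)))}.
      b (\<psi> n) < coord (\<psi> n) w \<and> coord (\<psi> n) w < t (\<psi> n)"
    using lim_Y[THEN eventually_less_of_tendsto[OF lim_levels(2)]]
      lim_Y[THEN eventually_less_of_tendsto[OF _ lim_levels(1)]] Y_strict Y_eq
    by (simp add: eventually_conj_iff)
  moreover have "\<forall>\<^sub>F n in sequentially. \<forall>w \<in> {p3 (z (\<sigma> n)), p4 (z (\<sigma> n)), midpoint (p1 (z (\<sigma> n))) (p2 (z (\<sigma> n)))}.
      l (\<psi> n) < coord (\<psi> n + pi / 2) w \<and> coord (\<psi> n + pi / 2) w < r (\<psi> n)"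
    using lim_X[THEN eventually_less_of_tendsto[OF lim_levels(4)]]
      lim_X[THEN eventually_less_of_tendsto[OF _ lim_levels(3)]] X_strict X_eq
    by (simp add: eventually_conj_iff)
  ultimately have "\<forall>\<^sub>F n in sequentially. False"
  proof eventually_elim
    case (elim n)
    let ?z = "z (\<sigma> n)"
    have "coord (\<psi> n) (p1 ?z) = coord (\<psi> n) (midpoint (p3 ?z) (p4 ?z))"
      "coord (\<psi> n) (p2 ?z) = coord (\<psi> n) (midpoint (p3 ?z) (p4 ?z))"
      "coord (\<psi> n + pi / 2) (p3 ?z) = coord (\<psi> n + pi / 2) (midpoint (p1 ?z) (p2 ?z))"
      "coord (\<psi> n + pi / 2) (p4 ?z) = coord (\<psi> n + pi / 2) (midpoint (p1 ?z) (p2 ?z))"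
      using eqs[of "\<sigma> n", folded \<psi>_def] elim by (simp_all add: trunc_ident)
    moreover from this have "midpoint (p1 ?z) (p2 ?z) = midpoint (p3 ?z) (p4 ?z)"
      by (intro coord_eqI[of "\<psi> n"]) (simp_all add: coord_midpoint)
    ultimately have "rhombus_of_angle (\<psi> n) (p1 ?z) (p3 ?z) (p2 ?z) (p4 ?z)"
      using elim by (intro rhombus_of_chords) auto
    moreover have "{p1 ?z, p3 ?z, p2 ?z, p4 ?z} \<subseteq> ?J"
      using in_J[OF z] by simp
    ultimately have "inscribed_rhombus_of_angle \<gamma> (\<psi> n) {p1 ?z, p3 ?z, p2 ?z, p4 ?z}"
      unfolding inscribed_rhombus_of_angle_def by blast
    with none show False
      unfolding \<psi>_def by blast
  qed
  then show False
    by simp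
qed

section \<open>An angle without special corners\<close>

text \<open>Let \<open>p q\<close> be a diameter of the curve and \<open>\<theta>\<close> its direction. As no two points of the curve
  are further apart, every point \<open>z\<close> has its \<open>X\<close>-value between those of \<open>p\<close> and \<open>q\<close>. If the value
  is strictly between, then both descents in \<open>X\<close> pass this level, and not both in \<open>z\<close>, because
  they only meet in extreme points. If it is that of \<open>p\<close> or \<open>q\<close>, a special corner \<open>z\<close> would have
  to be that point, but the line of angle \<open>\<theta>\<close> through it contains both \<open>p\<close> and \<open>q\<close>.\<close>

lemma cornerless_angle_exists:
  assumes jordan: "jordan_curve \<gamma>"
  shows "\<exists>\<theta>. \<nexists>p. special_corner_of_angle \<gamma> \<theta> p"
proof -
  let ?J = "curve_image \<gamma>"
  obtain u v where uv: "u \<in> ?J" "v \<in> ?J" "u \<noteq> v"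
    using coord_nonconstant[OF jordan] by metis
  have "compact ?J"
    using jordan by (auto simp: jordan_curve_def curve_image_def intro!: compact_continuous_image)
  then obtain p q where pq: "p \<in> ?J" "q \<in> ?J" and "dist p q = diameter ?J"
    using diameter_compact_attained uv by blast
  then have diam: "dist x y \<le> dist p q" if "x \<in> ?J" "y \<in> ?J" for x y
    using that \<open>compact ?J\<close> diameter_bounded_bound compact_imp_bounded by metis
  define d where "d = dist p q"
  have "p \<noteq> q"
    using diam[OF uv(1,2)] uv(3) by auto
  then have "d > 0"
    by (simp add: d_def)
  have "d\<^sup>2 = (p $ 1 - q $ 1)\<^sup>2 + (p $ 2 - q $ 2)\<^sup>2"
    by (simp add: d_def dist_vec_def L2_set_def sum_2 dist_real_def)
  moreover have "d\<^sup>2 \<noteq> 0"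
    using \<open>d > 0\<close> by simp
  ultimately have "((p $ 1 - q $ 1) / d)\<^sup>2 + ((p $ 2 - q $ 2) / d)\<^sup>2 = 1"
    by (metis add_divide_distrib divide_self power_divide)
  then obtain \<theta> where "(p $ 1 - q $ 1) / d = cos \<theta>" "(p $ 2 - q $ 2) / d = sin \<theta>"
    by (metis sincos_total_2pi)
  then have \<theta>: "p $ 1 = q $ 1 + d * cos \<theta>" "p $ 2 = q $ 2 + d * sin \<theta>"
    using \<open>d > 0\<close> by (auto simp: field_simps)
  let ?Y = "coord \<theta>" and ?X = "coord (\<theta> + pi / 2)"
  have Ypq: "?Y p = ?Y q"
    by (simp add: coord_def \<theta> algebra_simps)
  have "?X p = ?X q + d * ((cos \<theta>)\<^sup>2 + (sin \<theta>)\<^sup>2)"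
    unfolding coord_right_angle \<theta> by algebra
  then have Xpq: "?X p = ?X q + d"
    by simp
  have False if corner: "special_corner_of_angle \<gamma> \<theta> z" for z
  proof -
    have zJ: "z \<in> ?J" and zY: "\<And>w. w \<in> ?J \<Longrightarrow> ?Y w = ?Y z \<Longrightarrow> w = z"
      and zX: "\<And>w. w \<in> ?J \<Longrightarrow> ?X w = ?X z \<Longrightarrow> w = z"
      using corner unfolding special_corner_of_angle_coord by auto
    have "\<bar>?X z - ?X w\<bar> \<le> d" if "w \<in> ?J" for w
    proof -
      have "(?X z - ?X w)\<^sup>2 \<le> (dist z w)\<^sup>2"
        using dist_coord[of z w \<theta>] by simp
      then show ?thesis
        using diam[OF zJ that] abs_le_square_iff[of "?X z - ?X w" "dist z w"] by (simp add: d_def)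
    qed
    then have "?X q \<le> ?X z" "?X z \<le> ?X p"
      using pq Xpq by fastforce+
    moreover have "?X q \<noteq> ?X z" "?X p \<noteq> ?X z"
      using zX zY pq Ypq \<open>p \<noteq> q\<close> by metis+
    ultimately have between: "?X q < ?X z" "?X z < ?X p"
      by auto
    obtain P Q where PQ: "full_descent ?X ?J P" "full_descent ?X ?J Q"
      and meet: "\<forall>w \<in> P ` {0..1} \<inter> Q ` {0..1}. strictly_extremal ?X ?J w"
      by (rule full_descents_meeting_at_extremes[OF jordan continuous_on_coord coord_nonconstant[OF jordan]])
    have hits: "z \<in> R ` {0..1}" if R: "full_descent ?X ?J R" for R
    proof -
      have "continuous_on {0..1} (\<lambda>s. ?X (R s))"
        by (rule continuous_on_compose2[OF continuous_on_coord[of UNIV] full_descentD(1)[OF R]]) simp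
      then obtain s where "s \<in> {0..1}" "?X (R s) = ?X z"
        using IVT2'[of "\<lambda>s. ?X (R s)" 1 "?X z" 0] full_descentD(3,4)[OF R zJ] by auto
      then show ?thesis
        using zX full_descentD(2)[OF R] by blast
    qed
    have "strictly_extremal ?X ?J z"
      using meet hits PQ by blast
    then show False
      using between pq unfolding strictly_extremal_def
      by (metis Diff_iff less_asym less_irrefl singletonD)
  qed
  then show ?thesis
    by blast
qed

theorem theorem1p1:
  fixes \<gamma> :: "complex \<Rightarrow> real ^ 2"
  assumes "jordan_curve \<gamma>"
  shows "(\<exists>I :: real set. I \<noteq> {} \<and> open I \<and> is_interval I \<and>
            (\<forall>\<theta>\<in>I. \<exists>R. inscribed_rhombus_of_angle \<gamma> \<theta> R)) \<and>
         ((\<nexists>p. special_corner \<gamma> p) \<longrightarrow>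
            (\<forall>\<theta>::real. \<exists>R. inscribed_rhombus_of_angle \<gamma> \<theta> R))"
proof (intro conjI impI allI)
  obtain \<theta> \<epsilon> where "\<epsilon> > 0"
    and *: "\<And>\<phi>. \<bar>\<phi> - \<theta>\<bar> < \<epsilon> \<Longrightarrow> \<exists>R. inscribed_rhombus_of_angle \<gamma> \<phi> R"
    using cornerless_angle_exists[OF assms] rhombi_near_cornerless_angle[OF assms] by metis
  then show "\<exists>I :: real set. I \<noteq> {} \<and> open I \<and> is_interval I \<and>
      (\<forall>\<theta>\<in>I. \<exists>R. inscribed_rhombus_of_angle \<gamma> \<theta> R)"
    by (intro exI[of _ "{\<theta> - \<epsilon><..<\<theta> + \<epsilon>}"]) (auto simp: is_interval_convex_1)
next
  fix \<theta>
  assume "\<nexists>p. special_corner \<gamma> p"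
  then have "\<nexists>p. special_corner_of_angle \<gamma> \<theta> p"
    by (simp add: special_corner_def)
  then show "\<exists>R. inscribed_rhombus_of_angle \<gamma> \<theta> R"
    using rhombi_near_cornerless_angle[OF assms] by fastforce
qed

end
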